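(* The pair $(\ell_1,\ell_1)$ does not have the compact perturbation property for minimum modulus (CPPm).
   Context: For Banach spaces $X,Y$, $\mathcal{L}(X,Y)$ denotes the space of bounded linear operators from $X$ to $Y$, $\mathcal{K}(X,Y)$ the space of compact operators, and $S_X$ the unit sphere of $X$. The minimum modulus of $T\in\mathcal{L}(X,Y)$ is $m(T)=\inf\{\|Tx\|:x\in S_X\}$; $T$ attains its minimum modulus if $\|Tx\|=m(T)$ for some $x\in S_X$. The pair $(X,Y)$ has the compact perturbation property for minimum modulus (CPPm) if every $T\in\mathcal{L}(X,Y)$ that does not attain its minimum modulus satisfies $\sup_{K\in\mathcal{K}(X,Y)}m(T+K)=m(T)$. *)

theory Defs
  imports "HOL-Analysis.Analysis"
begin

typedef (overloaded) 'k l1 = "{x :: nat \<Rightarrow> 'k::real_normed_vector. summable (\<lambda>n. norm (x n))}"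
  morphisms l1_nth Abs_l1
  by (rule exI[of _ "\<lambda>_. 0"]) simp

setup_lifting type_definition_l1

lemma summable_norm_l1: "summable (\<lambda>n. norm (l1_nth x n))"
  using l1_nth[of x] by simp

lemma summable_norm_add:
  fixes x y :: "nat \<Rightarrow> 'k::real_normed_vector"
  assumes "summable (\<lambda>n. norm (x n))" "summable (\<lambda>n. norm (y n))"
  shows "summable (\<lambda>n. norm (x n + y n))"
  by (rule summable_comparison_test'[OF summable_add[OF assms], of 0])
     (simp add: norm_triangle_ineq)

lemma l1_eqI: "(\<And>n. l1_nth x n = l1_nth y n) \<Longrightarrow> x = y"
  by (simp add: l1_nth_inject[symmetric] fun_eq_iff)

instantiation l1 :: (real_normed_vector) real_normed_vector
begin

lift_definition zero_l1 :: "'a l1" is "\<lambda>_. 0" by simp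

lift_definition plus_l1 :: "'a l1 \<Rightarrow> 'a l1 \<Rightarrow> 'a l1" is "\<lambda>x y n. x n + y n"
  by (rule summable_norm_add)

lift_definition uminus_l1 :: "'a l1 \<Rightarrow> 'a l1" is "\<lambda>x n. - x n" by simp

lift_definition minus_l1 :: "'a l1 \<Rightarrow> 'a l1 \<Rightarrow> 'a l1" is "\<lambda>x y n. x n - y n"
  using summable_norm_add[of _ "\<lambda>n. - y n" for y] by simp

lift_definition scaleR_l1 :: "real \<Rightarrow> 'a l1 \<Rightarrow> 'a l1" is "\<lambda>r x n. r *\<^sub>R x n"
  by (simp add: summable_mult)

lift_definition norm_l1 :: "'a l1 \<Rightarrow> real" is "\<lambda>x. \<Sum>n. norm (x n)" .

definition "sgn (x :: 'a l1) = inverse (norm x) *\<^sub>R x"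
definition "dist (x :: 'a l1) y = norm (x - y)"
definition "(uniformity :: ('a l1 \<times> 'a l1) filter) = (INF e\<in>{0<..}. principal {(x, y). dist x y < e})"
definition "open (U :: 'a l1 set) \<longleftrightarrow> (\<forall>x\<in>U. \<forall>\<^sub>F (x', y) in uniformity. x' = x \<longrightarrow> y \<in> U)"

instance
proof
  fix a b c :: "'a l1" and r s :: real and U :: "'a l1 set"
  show "a + b + c = a + (b + c)" by transfer (simp add: add.assoc)
  show "a + b = b + a" by transfer (simp add: add.commute)
  show "0 + a = a" by transfer simp
  show "- a + a = 0" by transfer simp
  show "a - b = a + - b" by transfer simp
  show "r *\<^sub>R (a + b) = r *\<^sub>R a + r *\<^sub>R b" by transfer (simp add: scaleR_add_right)
  show "(r + s) *\<^sub>R a = r *\<^sub>R a + s *\<^sub>R a" by transfer (simp add: scaleR_add_left)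
  show "r *\<^sub>R s *\<^sub>R a = (r * s) *\<^sub>R a" by transfer simp
  show "1 *\<^sub>R a = a" by transfer simp
  show "dist a b = norm (a - b)" by (rule dist_l1_def)
  show "sgn a = inverse (norm a) *\<^sub>R a" by (rule sgn_l1_def)
  show "(uniformity :: ('a l1 \<times> 'a l1) filter) = (INF e\<in>{0<..}. principal {(x, y). dist x y < e})"
    by (rule uniformity_l1_def)
  show "open U \<longleftrightarrow> (\<forall>x\<in>U. \<forall>\<^sub>F (x', y) in uniformity. x' = x \<longrightarrow> y \<in> U)"
    by (rule open_l1_def)
  show "norm a = 0 \<longleftrightarrow> a = 0"
    by transfer (simp add: suminf_eq_zero_iff fun_eq_iff)
  show "norm (a + b) \<le> norm a + norm b"
  proof transfer
    fix x y :: "nat \<Rightarrow> 'a"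
    assume s: "summable (\<lambda>n. norm (x n))" "summable (\<lambda>n. norm (y n))"
    have "(\<Sum>n. norm (x n + y n)) \<le> (\<Sum>n. norm (x n) + norm (y n))"
      by (intro suminf_le norm_triangle_ineq summable_norm_add summable_add s)
    then show "(\<Sum>n. norm (x n + y n)) \<le> (\<Sum>n. norm (x n)) + (\<Sum>n. norm (y n))"
      by (simp add: suminf_add s)
  qed
  show "norm (r *\<^sub>R a) = \<bar>r\<bar> * norm a"
    by transfer (simp add: suminf_mult)
qed

end

lemma sum_norm_le_norm_l1: "(\<Sum>i<k. norm (l1_nth x i)) \<le> norm x"
  unfolding norm_l1.rep_eq by (rule sum_le_suminf) (auto simp: summable_norm_l1)

lemma norm_nth_le_norm_l1: "norm (l1_nth x i) \<le> norm x"
proof -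
  have "norm (l1_nth x i) \<le> (\<Sum>j<Suc i. norm (l1_nth x j))"
    by (simp add: sum_nonneg)
  then show ?thesis using sum_norm_le_norm_l1[of x "Suc i"] by linarith
qed

instance l1 :: (banach) banach
proof
  fix X :: "nat \<Rightarrow> 'a l1"
  assume X: "Cauchy X"
  have "Cauchy (\<lambda>m. l1_nth (X m) i)" for i
  proof (rule CauchyI)
    fix e :: real assume "e > 0"
    then obtain M where M: "\<And>m n. m \<ge> M \<Longrightarrow> n \<ge> M \<Longrightarrow> norm (X m - X n) < e"
      using CauchyD[OF X] by blast
    have "norm (l1_nth (X m) i - l1_nth (X n) i) < e" if "m \<ge> M" "n \<ge> M" for m n
      using norm_nth_le_norm_l1[of "X m - X n" i] M[OF that] by (simp add: minus_l1.rep_eq)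
    then show "\<exists>M. \<forall>m\<ge>M. \<forall>n\<ge>M. norm (l1_nth (X m) i - l1_nth (X n) i) < e" by blast
  qed
  then have "\<exists>l. (\<lambda>m. l1_nth (X m) i) \<longlonglongrightarrow> l" for i
    using Cauchy_convergent convergent_def by blast
  then obtain L where L: "\<And>i. (\<lambda>m. l1_nth (X m) i) \<longlonglongrightarrow> L i" by metis
  have tail: "\<exists>M. \<forall>m\<ge>M. summable (\<lambda>i. norm (l1_nth (X m) i - L i)) \<and>
      (\<Sum>i. norm (l1_nth (X m) i - L i)) \<le> e" if "e > 0" for e
  proof -
    obtain M where M: "\<And>m n. m \<ge> M \<Longrightarrow> n \<ge> M \<Longrightarrow> norm (X m - X n) < e"
      using CauchyD[OF X \<open>e > 0\<close>] by blast
    have le: "(\<Sum>i<k. norm (l1_nth (X m) i - L i)) \<le> e" if "m \<ge> M" for m k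
    proof (rule tendsto_upperbound)
      show "(\<lambda>n. \<Sum>i<k. norm (l1_nth (X m) i - l1_nth (X n) i)) \<longlonglongrightarrow>
          (\<Sum>i<k. norm (l1_nth (X m) i - L i))"
        by (intro tendsto_intros L)
      have "(\<Sum>i<k. norm (l1_nth (X m) i - l1_nth (X n) i)) \<le> e" if "n \<ge> M" for n
        using sum_norm_le_norm_l1[of "X m - X n" k] M[OF \<open>m \<ge> M\<close> that]
        by (simp add: minus_l1.rep_eq)
      then show "\<forall>\<^sub>F n in sequentially. (\<Sum>i<k. norm (l1_nth (X m) i - l1_nth (X n) i)) \<le> e"
        by (auto simp: eventually_sequentially)
    qed simp
    have "summable (\<lambda>i. norm (l1_nth (X m) i - L i))" if "m \<ge> M" for m
      by (rule summableI_nonneg_bounded[where x = e]) (use le that in auto)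
    then show ?thesis using le by (intro exI[of _ M]) (auto intro!: suminf_le_const)
  qed
  obtain m where m: "summable (\<lambda>i. norm (l1_nth (X m) i - L i))"
    using tail[of 1] by auto
  have "summable (\<lambda>i. norm (L i))"
    using summable_norm_add[OF summable_norm_l1[of "X m"], of "\<lambda>i. L i - l1_nth (X m) i"] m
    by (simp add: norm_minus_commute)
  then have nth: "l1_nth (Abs_l1 L) = L" by (simp add: Abs_l1_inverse)
  have "X \<longlonglongrightarrow> Abs_l1 L"
  proof (rule LIMSEQ_I)
    fix e :: real assume "e > 0"
    then obtain M where "\<And>m. m \<ge> M \<Longrightarrow> (\<Sum>i. norm (l1_nth (X m) i - L i)) \<le> e / 2"
      using tail[of "e / 2"] by auto
    then have "norm (X m - Abs_l1 L) < e" if "m \<ge> M" for m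
      using that \<open>e > 0\<close> by (force simp: norm_l1.rep_eq minus_l1.rep_eq nth)
    then show "\<exists>M. \<forall>m\<ge>M. norm (X m - Abs_l1 L) < e" by blast
  qed
  then show "convergent X" by (auto simp: convergent_def)
qed

text \<open>
  The class \<^class>\<open>banach\<close> only knows real scalars. A Banach space over a field \<open>'k\<close>
  (\<open>real\<close> or \<open>complex\<close>) is a type of that class together with a scalar multiplication
  by \<open>'k\<close> that is compatible with the norm and extends the real one.
\<close>

locale banach_space_over = vector_space scale
  for scale :: "'k::real_normed_field \<Rightarrow> 'a::banach \<Rightarrow> 'a" +
  assumes norm_scale: "norm (scale c x) = norm c * norm x"
    and scale_of_real: "scale (of_real r) x = r *\<^sub>R x"

lemma banach_space_over_scaleR:
  "banach_space_over (scaleR :: real \<Rightarrow> 'a::banach \<Rightarrow> 'a)"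
  by unfold_locales (simp_all add: scaleR_add_right scaleR_add_left)

lift_definition scale_l1 :: "'k::real_normed_field \<Rightarrow> 'k l1 \<Rightarrow> 'k l1" is "\<lambda>c x n. c * x n"
  by (simp add: norm_mult summable_mult)

lemma banach_space_over_scale_l1:
  "banach_space_over (scale_l1 :: 'k::{real_normed_field,banach} \<Rightarrow> 'k l1 \<Rightarrow> 'k l1)"
proof
  fix a b c :: 'k and x y :: "'k l1" and r :: real
  show "scale_l1 a (x + y) = scale_l1 a x + scale_l1 a y" by transfer (simp add: distrib_left)
  show "scale_l1 (a + b) x = scale_l1 a x + scale_l1 b x" by transfer (simp add: distrib_right)
  show "scale_l1 a (scale_l1 b x) = scale_l1 (a * b) x" by transfer (simp add: mult.assoc)
  show "scale_l1 1 x = x" by transfer simp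
  show "norm (scale_l1 c x) = norm c * norm x" by transfer (simp add: norm_mult suminf_mult)
  show "scale_l1 (of_real r) x = r *\<^sub>R x" by transfer (simp add: scaleR_conv_of_real)
qed

definition bounded_operators ::
  "('k::real_normed_field \<Rightarrow> 'a::banach \<Rightarrow> 'a) \<Rightarrow> ('k \<Rightarrow> 'b::banach \<Rightarrow> 'b) \<Rightarrow> ('a \<Rightarrow> 'b) set" where
  "bounded_operators s t = {T. Vector_Spaces.linear s t T \<and> bounded_linear T}"

definition compact_operators ::
  "('k::real_normed_field \<Rightarrow> 'a::banach \<Rightarrow> 'a) \<Rightarrow> ('k \<Rightarrow> 'b::banach \<Rightarrow> 'b) \<Rightarrow> ('a \<Rightarrow> 'b) set" where
  "compact_operators s t = {K \<in> bounded_operators s t. compact (closure (K ` cball 0 1))}"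

definition min_modulus :: "('a::banach \<Rightarrow> 'b::banach) \<Rightarrow> real" where
  "min_modulus T = (INF x\<in>sphere 0 1. norm (T x))"

definition attains_min_modulus :: "('a::banach \<Rightarrow> 'b::banach) \<Rightarrow> bool" where
  "attains_min_modulus T \<longleftrightarrow> (\<exists>x\<in>sphere 0 1. norm (T x) = min_modulus T)"

text \<open>
  The supremum is taken in the extended reals, so that it is meaningful without knowing
  beforehand that the values are bounded.
\<close>

definition CPPm ::
  "('k::real_normed_field \<Rightarrow> 'a::banach \<Rightarrow> 'a) \<Rightarrow> ('k \<Rightarrow> 'b::banach \<Rightarrow> 'b) \<Rightarrow> bool" where
  "CPPm s t \<longleftrightarrow>
    (\<forall>T\<in>bounded_operators s t. \<not> attains_min_modulus T \<longrightarrow>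
      (SUP K\<in>compact_operators s t. ereal (min_modulus (\<lambda>x. T x + K x))) = ereal (min_modulus T))"

end

theory Submission
  imports Defs
begin

text \<open>
  With \<open>f x = (\<Sum>n. n / (n + 1) * x\<^sub>n)\<close>, the operator \<open>T x = x - f x e\<^sub>0\<close> is a rank one
  perturbation of the identity, whose minimum modulus is 1. If \<open>s\<close> is the norm of a unit vector
  \<open>x\<close> off the coordinate 0, then \<open>\<parallel>T x\<parallel> = \<bar>x\<^sub>0 - f x\<bar> + s\<close> is at least \<open>s\<close>, and at least
  \<open>1 - \<bar>f x\<bar>\<close>, where \<open>\<bar>f x\<bar> < s\<close> unless \<open>s = 0\<close>. Hence \<open>\<parallel>T x\<parallel> > 1/2\<close>, while the vectors
  \<open>(e\<^sub>0 + e\<^sub>n) / 2\<close> show that the infimum is 1/2.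
\<close>

lift_definition unit_l1 :: "nat \<Rightarrow> 'k::real_normed_field l1" is "\<lambda>n k. if k = n then 1 else 0"
  by (rule summable_finite[where N = "{_}"]) auto

text \<open>The weight at 0 vanishes, so only the tail of \<open>x\<close> off coordinate 0 counts.
  The weights tend to 1 without reaching it, so the functional has norm 1 but does not attain
  it.\<close>

definition weight_functional :: "'k::{real_normed_field,banach} l1 \<Rightarrow> 'k" where
  "weight_functional x = (\<Sum>n. of_real (real n / (real n + 1)) * l1_nth x n)"

definition weight_rank1 :: "'k::{real_normed_field,banach} l1 \<Rightarrow> 'k l1" where
  "weight_rank1 x = scale_l1 (weight_functional x) (unit_l1 0)"

lemma norm_unit_l1 [simp]: "norm (unit_l1 n) = 1"
  by transfer (subst suminf_finite[where N = "{n}" for n]; simp)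

text \<open>Bounding the infimum in \<open>min_modulus\<close> from below, and evaluating it for the
  identity, both require a nonempty sphere.\<close>

lemma sphere_l1_nonempty: "sphere (0 :: 'k::real_normed_field l1) 1 \<noteq> {}"
  by (metis empty_iff mem_sphere_0 norm_unit_l1)

lemma norm_l1_split_head:
  "norm x = norm (l1_nth x 0) + (\<Sum>n. norm (l1_nth x (Suc n)))"
  using suminf_split_head[OF summable_norm_l1[of x]] by (simp add: norm_l1.rep_eq)

text \<open>Only coordinate 0 changes. The norm of the untouched tail appears, here and below, as
  \<open>norm x - norm (l1_nth x 0)\<close>.\<close>

lemma norm_diff_scale_unit_l1_0:
  "norm (x - scale_l1 c (unit_l1 0)) = norm x - norm (l1_nth x 0) + norm (l1_nth x 0 - c)"
  by (subst (1 2) norm_l1_split_head) (simp add: minus_l1.rep_eq scale_l1.rep_eq unit_l1.rep_eq)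

lemma summable_norm_weight:
  "summable (\<lambda>n. norm (of_real (real n / (real n + 1)) * l1_nth x n :: 'k::real_normed_field))"
  by (rule summable_comparison_test'[OF summable_norm_l1[of x], of 0])
     (simp add: norm_mult divide_le_eq algebra_simps del: of_real_divide)

lemma summable_weight:
  "summable (\<lambda>n. of_real (real n / (real n + 1)) * l1_nth x n :: 'k::{real_normed_field,banach})"
  by (rule summable_norm_cancel[OF summable_norm_weight])

text \<open>Since n/(n+1) = 1 - 1/(n+1), summing the norms of the terms gives \<open>norm x\<close>
  minus a deficit series. Its terms are nonnegative, so finitely many of them already bound the
  deficit from below.\<close>

lemma norm_weight_functional_le:
  "norm (weight_functional x) \<le> norm x - (\<Sum>n. norm (l1_nth x n) / (real n + 1))"
  and sum_weight_le:
  "finite A \<Longrightarrow> (\<Sum>n\<in>A. norm (l1_nth x n) / (real n + 1)) \<le> (\<Sum>n. norm (l1_nth x n) / (real n + 1))"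
proof -
  have s: "summable (\<lambda>n. norm (l1_nth x n) / (real n + 1))"
    by (rule summable_comparison_test'[OF summable_norm_l1[of x], of 0])
       (simp add: divide_le_eq mult_le_cancel_left1)
  have "norm (of_real (real n / (real n + 1)) * l1_nth x n)
      = norm (l1_nth x n) - norm (l1_nth x n) / (real n + 1)" for n
    by (simp add: norm_mult field_simps del: of_real_divide)
  then have "(\<Sum>n. norm (of_real (real n / (real n + 1)) * l1_nth x n))
      = norm x - (\<Sum>n. norm (l1_nth x n) / (real n + 1))"
    by (simp only: norm_l1.rep_eq suminf_diff[OF summable_norm_l1 s])
  then show "norm (weight_functional x) \<le> norm x - (\<Sum>n. norm (l1_nth x n) / (real n + 1))"
    unfolding weight_functional_def using summable_norm[OF summable_norm_weight[of x]] by simp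
  show "(\<Sum>n\<in>A. norm (l1_nth x n) / (real n + 1)) \<le> (\<Sum>n. norm (l1_nth x n) / (real n + 1))"
    if "finite A" using that by (intro sum_le_suminf s) auto
qed

lemma norm_weight_functional_le_tail:
  "norm (weight_functional x) \<le> norm x - norm (l1_nth x 0)"
  using norm_weight_functional_le[of x] sum_weight_le[of "{0}" x] by simp

lemma norm_weight_functional_less_tail:
  assumes "norm (l1_nth x 0) < norm x"
  shows "norm (weight_functional x) < norm x - norm (l1_nth x 0)"
proof -
  \<comment> \<open>A nonzero tail coordinate adds a positive term to the deficit, on top of the
    term \<open>norm (l1_nth x 0)\<close> at index 0.\<close>
  obtain n where n: "l1_nth x (Suc n) \<noteq> 0"
    using assms norm_l1_split_head[of x] by fastforce
  then have "norm (l1_nth x (Suc n)) / (real (Suc n) + 1) > 0" by simp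
  then show ?thesis
    using norm_weight_functional_le[of x] sum_weight_le[of "{0, Suc n}" x] by simp
qed

lemma norm_diff_weight_rank1_gt:
  assumes "norm x = 1"
  shows "norm (x - weight_rank1 x) > 1 / 2"
proof -
  have "norm (l1_nth x 0) - norm (weight_functional x) \<le> norm (l1_nth x 0 - weight_functional x)"
    by (rule norm_triangle_ineq2)
  moreover have "norm (l1_nth x 0) \<le> norm x" by (rule norm_nth_le_norm_l1)
  \<comment> \<open>Let s be the tail norm. In the first case the norm to be bounded is at least s
    and more than 1 - s, hence above 1/2. In the second case s = 0, so the functional vanishes at
    \<open>x\<close> and the norm is 1.\<close>
  moreover have "norm (weight_functional x) < norm x - norm (l1_nth x 0) \<or> norm (l1_nth x 0) = norm x"
    using norm_weight_functional_less_tail[of x] norm_nth_le_norm_l1[of x 0] by linarith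
  ultimately show ?thesis
    using norm_weight_functional_le_tail[of x] norm_ge_zero[of "l1_nth x 0 - weight_functional x"] assms
    unfolding weight_rank1_def norm_diff_scale_unit_l1_0 by argo
qed

lemma ex_norm_diff_weight_rank1:
  "\<exists>x :: 'k::{real_normed_field,banach} l1.
    norm x = 1 \<and> norm (x - weight_rank1 x) = 1 / 2 + 1 / (2 * (real (Suc n) + 1))"
proof -
  \<comment> \<open>The index \<open>Suc n\<close> keeps the two unit vectors distinct. The tail
    contributes 1/2 to the norm of the image, and coordinate 0 contributes half of 1 -
    (n+1)/(n+2).\<close>
  define x :: "'k l1" where "x = (1 / 2) *\<^sub>R (unit_l1 0 + unit_l1 (Suc n))"
  have nth: "l1_nth x k = (if k = 0 \<or> k = Suc n then of_real (1 / 2) else 0)" for k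
    by (simp add: x_def scaleR_l1.rep_eq plus_l1.rep_eq unit_l1.rep_eq scaleR_conv_of_real)
  have nx: "norm x = 1"
    unfolding norm_l1.rep_eq by (subst suminf_finite[of "{0, Suc n}"]) (auto simp: nth norm_divide)
  have f: "weight_functional x = of_real (real (Suc n) / (real (Suc n) + 1) * (1 / 2))"
    unfolding weight_functional_def
    by (subst suminf_finite[of "{0, Suc n}"]) (auto simp: nth)
  have "norm (l1_nth x 0 - weight_functional x) = \<bar>1 / 2 - real (Suc n) / (real (Suc n) + 1) * (1 / 2)\<bar>"
    unfolding f nth by (simp only: of_real_diff[symmetric] norm_of_real if_True simp_thms)
  also have "\<dots> = 1 / (2 * (real (Suc n) + 1))"
    by (simp add: field_simps)
  finally have "norm (x - weight_rank1 x) = 1 / 2 + 1 / (2 * (real (Suc n) + 1))"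
    unfolding weight_rank1_def norm_diff_scale_unit_l1_0 nx by (simp add: nth norm_divide)
  with nx show ?thesis by blast
qed

lemma min_modulus_diff_weight_rank1:
  "min_modulus (\<lambda>x :: 'k::{real_normed_field,banach} l1. x - weight_rank1 x) = 1 / 2"
  unfolding min_modulus_def
proof (rule antisym)
  let ?m = "INF x\<in>sphere (0 :: 'k l1) 1. norm (x - weight_rank1 x)"
  have bdd: "bdd_below ((\<lambda>x :: 'k l1. norm (x - weight_rank1 x)) ` sphere 0 1)"
    by (rule bdd_belowI2[of _ 0]) simp
  \<comment> \<open>The excess over 1/2 is enlarged to a standard null sequence, so that letting n
    grow gives the upper bound.\<close>
  have "?m \<le> 1 / 2 + inverse (real (Suc n))" for n
  proof -
    have "?m \<le> 1 / 2 + 1 / (2 * (real (Suc n) + 1))"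
      using ex_norm_diff_weight_rank1[of n, where 'k = 'k] cINF_lower[OF bdd] by force
    also have "\<dots> \<le> 1 / 2 + inverse (real (Suc n))"
      by (simp add: divide_simps) (simp add: algebra_simps)
    finally show ?thesis .
  qed
  then show "?m \<le> 1 / 2"
    by (intro tendsto_lowerbound[OF LIMSEQ_inverse_real_of_nat_add]) auto
  show "1 / 2 \<le> ?m"
  proof (rule cINF_greatest[OF sphere_l1_nonempty])
    fix x :: "'k l1" assume "x \<in> sphere 0 1"
    then show "1 / 2 \<le> norm (x - weight_rank1 x)"
      by (intro less_imp_le norm_diff_weight_rank1_gt) simp
  qed
qed

lemma linear_weight_rank1:
  "Vector_Spaces.linear scale_l1 scale_l1 (weight_rank1 :: 'k::{real_normed_field,banach} l1 \<Rightarrow> _)"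
proof -
  interpret banach_space_over "scale_l1 :: 'k \<Rightarrow> 'k l1 \<Rightarrow> 'k l1"
    by (rule banach_space_over_scale_l1)
  have "weight_functional (x + y) = weight_functional x + weight_functional y" for x y :: "'k l1"
    unfolding weight_functional_def
    by (simp add: suminf_add[OF summable_weight summable_weight] plus_l1.rep_eq distrib_left
        del: of_real_divide)
  moreover have "weight_functional (scale_l1 c x) = c * weight_functional x" for c and x :: "'k l1"
    unfolding weight_functional_def
    by (simp add: suminf_mult[OF summable_weight, symmetric] scale_l1.rep_eq mult.left_commute
        del: of_real_divide)
  ultimately show ?thesis
    by unfold_locales (simp_all add: weight_rank1_def scale_left_distrib)
qed

lemma bounded_linear_weight_rank1:
  "bounded_linear (weight_rank1 :: 'k::{real_normed_field,banach} l1 \<Rightarrow> _)"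
proof -
  interpret banach_space_over "scale_l1 :: 'k \<Rightarrow> 'k l1 \<Rightarrow> 'k l1"
    by (rule banach_space_over_scale_l1)
  interpret Vector_Spaces.linear scale_l1 scale_l1 "weight_rank1 :: 'k l1 \<Rightarrow> 'k l1"
    by (rule linear_weight_rank1)
  show ?thesis
  proof (rule bounded_linear_intro[where K = 1])
    fix x y :: "'k l1" and r :: real
    show "weight_rank1 (x + y) = weight_rank1 x + weight_rank1 y" by (rule add)
    \<comment> \<open>Real homogeneity is homogeneity over \<open>'k\<close> at the scalar
      \<open>of_real r\<close>.\<close>
    show "weight_rank1 (r *\<^sub>R x) = r *\<^sub>R weight_rank1 x"
      by (simp flip: scale_of_real add: scale)
    show "norm (weight_rank1 x) \<le> norm x * 1"
      using norm_weight_functional_le_tail[of x] norm_ge_zero[of "l1_nth x 0"]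
      unfolding weight_rank1_def norm_scale norm_unit_l1 by linarith
  qed
qed

text \<open>The functional maps the unit ball into the unit ball of \<open>'k\<close>, which is
  compact by the Heine-Borel property. The image under the operator thus lies in \<open>?C\<close>,
  a Lipschitz image of that ball, and its closure is a closed subset of a compact set.\<close>

lemma weight_rank1_compact:
  "(weight_rank1 :: 'k::{real_normed_field,banach,heine_borel} l1 \<Rightarrow> _)
    \<in> compact_operators scale_l1 scale_l1"
proof -
  interpret banach_space_over "scale_l1 :: 'k \<Rightarrow> 'k l1 \<Rightarrow> 'k l1"
    by (rule banach_space_over_scale_l1)
  let ?C = "(\<lambda>c :: 'k. scale_l1 c (unit_l1 0)) ` cball 0 1"
  have "1-lipschitz_on (cball 0 1) (\<lambda>c :: 'k. scale_l1 c (unit_l1 0))"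
    by (rule lipschitz_onI) (simp_all add: dist_norm norm_scale flip: scale_left_diff_distrib)
  then have C: "compact ?C"
    by (rule compact_continuous_image[OF lipschitz_on_continuous_on compact_cball])
  have "weight_rank1 ` cball 0 1 \<subseteq> ?C"
  proof (rule image_subsetI)
    fix x :: "'k l1" assume "x \<in> cball 0 1"
    then have "norm (weight_functional x) \<le> 1"
      using norm_weight_functional_le_tail[of x] norm_ge_zero[of "l1_nth x 0"]
      by (simp del: norm_ge_zero)
    then show "weight_rank1 x \<in> ?C"
      unfolding weight_rank1_def by (intro imageI) simp
  qed
  then have "closure (weight_rank1 ` cball 0 1) \<subseteq> ?C"
    by (rule closure_minimal) (rule compact_imp_closed[OF C])
  then have "compact (closure (weight_rank1 ` cball (0 :: 'k l1) 1))"
    using compact_Int_closed[OF C closed_closure, of "weight_rank1 ` cball 0 1"]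
    by (simp only: Int_absorb1)
  then show ?thesis
    by (simp add: compact_operators_def bounded_operators_def linear_weight_rank1
        bounded_linear_weight_rank1)
qed

text \<open>Adding the compact operator \<open>weight_rank1\<close> to \<open>?T\<close> restores
  the identity, so the supremum is at least 1, while the property would force it to be 1/2. The
  class constraints on \<open>'k\<close> cover both the real and the complex scalars.\<close>

lemma not_CPPm_scale_l1:
  "\<not> CPPm (scale_l1 :: 'k::{real_normed_field,banach,heine_borel} \<Rightarrow> 'k l1 \<Rightarrow> 'k l1) scale_l1"
proof
  interpret banach_space_over "scale_l1 :: 'k \<Rightarrow> 'k l1 \<Rightarrow> 'k l1"
    by (rule banach_space_over_scale_l1)
  interpret vector_space_pair "scale_l1 :: 'k \<Rightarrow> 'k l1 \<Rightarrow> 'k l1" "scale_l1 :: 'k \<Rightarrow> 'k l1 \<Rightarrow> 'k l1"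
    by unfold_locales
  let ?T = "\<lambda>x :: 'k l1. x - weight_rank1 x"
  assume "CPPm (scale_l1 :: 'k \<Rightarrow> 'k l1 \<Rightarrow> 'k l1) scale_l1"
  moreover have "?T \<in> bounded_operators scale_l1 scale_l1"
    unfolding bounded_operators_def
    by (auto intro!: linear_compose_sub linear_ident linear_weight_rank1 bounded_linear_sub
        bounded_linear_ident bounded_linear_weight_rank1)
  moreover have "\<not> attains_min_modulus ?T"
    unfolding attains_min_modulus_def min_modulus_diff_weight_rank1
    using norm_diff_weight_rank1_gt by force
  ultimately have "(SUP K\<in>compact_operators scale_l1 scale_l1. ereal (min_modulus (\<lambda>x. ?T x + K x)))
      = ereal (min_modulus ?T)"
    unfolding CPPm_def by (elim ballE[where x = ?T] impE) simp_all
  then have "ereal (min_modulus (\<lambda>x. ?T x + weight_rank1 x)) \<le> ereal (min_modulus ?T)"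
    using SUP_upper[OF weight_rank1_compact, of "\<lambda>K. ereal (min_modulus (\<lambda>x. ?T x + K x))"]
    by (simp only:)
  moreover have "min_modulus (\<lambda>x. ?T x + weight_rank1 x) = 1"
    by (simp add: min_modulus_def sphere_l1_nonempty)
  ultimately show False by (simp add: min_modulus_diff_weight_rank1)
qed

theorem mainTheorem5:
  shows "\<not> CPPm (scale_l1 :: real \<Rightarrow> real l1 \<Rightarrow> real l1) (scale_l1 :: real \<Rightarrow> real l1 \<Rightarrow> real l1)
    \<and> \<not> CPPm (scale_l1 :: complex \<Rightarrow> complex l1 \<Rightarrow> complex l1)
        (scale_l1 :: complex \<Rightarrow> complex l1 \<Rightarrow> complex l1)"
  by (intro conjI not_CPPm_scale_l1)

end
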